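(* Let $A=\{a_{ij}\}_{i,j=0,1,2,\ldots}$ be a double sequence of complex constants that defines a regular method of summability, and let $g(z)=\sum_{i=0}^{\infty} g_i z^i$ and $h(z)=\sum_{j=0}^{\infty} h_j z^j$ be two complex power series. Then for any complex number $z$ such that $\lim_{i\to\infty} g_i z^i$ and $\lim_{j\to\infty} h_j z^j$ exist, the following two conditions are equivalent: (i) $\lim_{i\to\infty} g_i z^i\cdot\lim_{j\to\infty} h_j z^j = 1$; (ii) the double sequence $P_{A;g,h}(z)=\{a_{ij}\,g_i\,h_j\,z^{i+j}\}_{i,j=0,1,2,\ldots}$ defines a regular method of summability.
   Context: Let $c$ be the space of all convergent sequences of complex scalars. A double sequence $B=\{b_{ij}\}_{i,j=0,1,2,\ldots}$ of complex constants is said to define a regular method of summability if the formula $T[s_0,s_1,\ldots]=[t_0,t_1,\ldots]$, with $t_i=\sum_{j=0}^{\infty} b_{ij}s_j$ for $i=0,1,2,\ldots$, defines a linear transformation $T$ of $c$ into itself (in particular all the series converge for every $[s_j]\in c$) which preserves limits, i.e. $\lim_{i\to\infty}t_i=\lim_{i\to\infty}s_i$ for every $[s_i]\in c$. The convention $z^0=1$ is used for all $z$, including $z=0$. Limits are limits in $\mathbb{C}$ (finite). The double sequence $P_{A;g,h}(z)$ is called the power double sequence of third type induced by $A$ and associated with $g$ and $h$. *)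

theory Defs
  imports Complex_Main "HOL-Computational_Algebra.Formal_Power_Series"
begin

definition conv_seqs :: "(nat \<Rightarrow> complex) set" where
  "conv_seqs = {s. convergent s}"

definition matrix_transform ::
    "(nat \<Rightarrow> nat \<Rightarrow> complex) \<Rightarrow> (nat \<Rightarrow> complex) \<Rightarrow> nat \<Rightarrow> complex" where
  "matrix_transform b s = (\<lambda>i. \<Sum>j. b i j * s j)"

text \<open>
  Since \<^const>\<open>suminf\<close> is total, convergence of all the series has to be required explicitly.
  Linearity is stated as part of the notion although it follows from that convergence.
\<close>

definition regular_summability :: "(nat \<Rightarrow> nat \<Rightarrow> complex) \<Rightarrow> bool" where
  "regular_summability b \<longleftrightarrow>
     (\<forall>s\<in>conv_seqs. \<forall>i. summable (\<lambda>j. b i j * s j)) \<and>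
     (\<forall>s\<in>conv_seqs. matrix_transform b s \<in> conv_seqs) \<and>
     (\<forall>s\<in>conv_seqs. \<forall>s'\<in>conv_seqs.
        matrix_transform b (\<lambda>j. s j + s' j) =
        (\<lambda>i. matrix_transform b s i + matrix_transform b s' i)) \<and>
     (\<forall>s\<in>conv_seqs. \<forall>k.
        matrix_transform b (\<lambda>j. k * s j) = (\<lambda>i. k * matrix_transform b s i)) \<and>
     (\<forall>s\<in>conv_seqs. lim (matrix_transform b s) = lim s)"

definition power_double_seq_third ::
    "(nat \<Rightarrow> nat \<Rightarrow> complex) \<Rightarrow> complex fps \<Rightarrow> complex fps \<Rightarrow> complex \<Rightarrow> nat \<Rightarrow> nat \<Rightarrow> complex" where
  "power_double_seq_third a g h z = (\<lambda>i j. a i j * fps_nth g i * fps_nth h j * z ^ (i + j))"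

end

theory Submission imports Defs begin

text \<open>
  Put \<open>u\<^sub>i = g\<^sub>i z\<^sup>i\<close> and \<open>v\<^sub>j = h\<^sub>j z\<^sup>j\<close>. Since \<open>z\<^sup>i\<^sup>+\<^sup>j = z\<^sup>i z\<^sup>j\<close>, the power double sequence is
  \<open>u\<^sub>i a\<^sub>i\<^sub>j v\<^sub>j\<close>, so its transformation is a composition of three: multiply the input
  pointwise by \<open>v\<close>, apply the regular method \<open>a\<close>, multiply the output pointwise by \<open>u\<close>.
  If \<open>u\<close> and \<open>v\<close> converge to \<open>U\<close> and \<open>V\<close>, each factor maps convergent sequences to convergent
  sequences and the composition multiplies every limit by \<open>U V\<close>
  (lemma \<open>matrix_transform_diagonal_scaling_limit\<close>). Such a transformation preserves all limits
  exactly when \<open>U V = 1\<close>; the constant sequence \<open>1\<close> shows that this is necessary.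
\<close>

text \<open>
  Testing regularity on one sequence at a time, with its limit named, lets limits be computed
  by the rules for \<open>\<longlonglongrightarrow>\<close> instead of through \<^const>\<open>lim\<close>. From right to left, linearity comes from
  the convergence of all the series, since convergent series add and scale termwise.
\<close>

lemma regular_summability_iff_tendsto:
  "regular_summability b \<longleftrightarrow>
     (\<forall>s l. s \<longlonglongrightarrow> l \<longrightarrow> (\<forall>i. summable (\<lambda>j. b i j * s j)) \<and> matrix_transform b s \<longlonglongrightarrow> l)"
  (is "?L \<longleftrightarrow> ?R")
proof
  assume reg: ?L
  show ?R
  proof (intro allI impI)
    fix s :: "nat \<Rightarrow> complex" and l assume s: "s \<longlonglongrightarrow> l"
    then have c: "s \<in> conv_seqs"
      by (auto simp: conv_seqs_def convergent_def)
    then have "matrix_transform b s \<longlonglongrightarrow> lim (matrix_transform b s)"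
      using reg by (auto simp: regular_summability_def conv_seqs_def convergent_LIMSEQ_iff)
    moreover have "lim (matrix_transform b s) = l"
      using reg c limI[OF s] by (simp add: regular_summability_def)
    ultimately show "(\<forall>i. summable (\<lambda>j. b i j * s j)) \<and> matrix_transform b s \<longlonglongrightarrow> l"
      using reg c by (simp add: regular_summability_def)
  qed
next
  assume R: ?R
  have sm: "summable (\<lambda>j. b i j * s j)" if "s \<in> conv_seqs" for s i
    using R that by (auto simp: conv_seqs_def convergent_def)
  have lm: "matrix_transform b s \<longlonglongrightarrow> lim s" if "s \<in> conv_seqs" for s
    using R that by (auto simp: conv_seqs_def convergent_LIMSEQ_iff)
  have add: "matrix_transform b (\<lambda>j. s j + s' j) =
      (\<lambda>i. matrix_transform b s i + matrix_transform b s' i)"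
    if "s \<in> conv_seqs" "s' \<in> conv_seqs" for s s'
    using suminf_add[OF sm[OF that(1)] sm[OF that(2)]]
    by (auto simp: matrix_transform_def distrib_left)
  have scale: "matrix_transform b (\<lambda>j. k * s j) = (\<lambda>i. k * matrix_transform b s i)"
    if "s \<in> conv_seqs" for s k
    using suminf_mult[OF sm[OF that]]
    by (auto simp: matrix_transform_def mult.left_commute)
  have "matrix_transform b s \<in> conv_seqs" if "s \<in> conv_seqs" for s
    using lm[OF that] by (auto simp: conv_seqs_def convergent_def)
  then show ?L
    unfolding regular_summability_def using sm add scale limI[OF lm] by blast
qed

lemma matrix_transform_diagonal_scaling:
  assumes "\<And>i. summable (\<lambda>j. a i j * (v j * s j))"
  shows "summable (\<lambda>j. u i * a i j * v j * s j)"
    and "matrix_transform (\<lambda>i j. u i * a i j * v j) s =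
           (\<lambda>i. u i * matrix_transform a (\<lambda>j. v j * s j) i)"
proof -
  show "summable (\<lambda>j. u i * a i j * v j * s j)"
    using summable_mult[OF assms, of "u i" i] by (simp add: mult.assoc)
  show "matrix_transform (\<lambda>i j. u i * a i j * v j) s =
      (\<lambda>i. u i * matrix_transform a (\<lambda>j. v j * s j) i)"
    using suminf_mult[OF assms] by (auto simp: matrix_transform_def mult.assoc)
qed

text \<open>
  Regularity of \<open>a\<close> is applied to the sequence \<open>v\<^sub>j s\<^sub>j\<close>, whose limit is \<open>V l\<close>; the row factors
  \<open>u\<^sub>i\<close> come out of the series and contribute \<open>U\<close>.
\<close>

lemma matrix_transform_diagonal_scaling_limit:
  assumes a: "regular_summability a" and u: "u \<longlonglongrightarrow> U" and v: "v \<longlonglongrightarrow> V" and s: "s \<longlonglongrightarrow> l"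
  shows "summable (\<lambda>j. u i * a i j * v j * s j)"
    and "matrix_transform (\<lambda>i j. u i * a i j * v j) s \<longlonglongrightarrow> U * V * l"
proof -
  have "(\<lambda>j. v j * s j) \<longlonglongrightarrow> V * l"
    by (intro tendsto_mult v s)
  then have sm: "\<And>i. summable (\<lambda>j. a i j * (v j * s j))"
    and lm: "matrix_transform a (\<lambda>j. v j * s j) \<longlonglongrightarrow> V * l"
    using a by (auto simp: regular_summability_iff_tendsto)
  show "summable (\<lambda>j. u i * a i j * v j * s j)"
    by (rule matrix_transform_diagonal_scaling(1)[OF sm])
  show "matrix_transform (\<lambda>i j. u i * a i j * v j) s \<longlonglongrightarrow> U * V * l"
    using tendsto_mult[OF u lm]
    unfolding matrix_transform_diagonal_scaling(2)[OF sm] by (simp only: mult.assoc)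
qed

lemma regular_summability_diagonal_scaling_iff:
  assumes a: "regular_summability a" and u: "u \<longlonglongrightarrow> U" and v: "v \<longlonglongrightarrow> V"
  shows "regular_summability (\<lambda>i j. u i * a i j * v j) \<longleftrightarrow> U * V = 1"
proof
  assume reg: "regular_summability (\<lambda>i j. u i * a i j * v j)"
  have one: "(\<lambda>_. 1 :: complex) \<longlonglongrightarrow> 1"
    by simp
  have "matrix_transform (\<lambda>i j. u i * a i j * v j) (\<lambda>_. 1) \<longlonglongrightarrow> 1"
    using reg one unfolding regular_summability_iff_tendsto by blast
  with matrix_transform_diagonal_scaling_limit(2)[OF a u v one]
  show "U * V = 1"
    using LIMSEQ_unique by fastforce
next
  assume "U * V = 1"
  then show "regular_summability (\<lambda>i j. u i * a i j * v j)"
    using matrix_transform_diagonal_scaling_limit[OF a u v]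
    by (simp add: regular_summability_iff_tendsto)
qed

theorem theorem1:
  fixes a :: "nat \<Rightarrow> nat \<Rightarrow> complex" and g h :: "complex fps" and z :: complex
  assumes "regular_summability a"
    and "convergent (\<lambda>i. fps_nth g i * z ^ i)"
    and "convergent (\<lambda>j. fps_nth h j * z ^ j)"
  shows "lim (\<lambda>i. fps_nth g i * z ^ i) * lim (\<lambda>j. fps_nth h j * z ^ j) = 1
     \<longleftrightarrow> regular_summability (power_double_seq_third a g h z)"
proof -
  have "power_double_seq_third a g h z =
      (\<lambda>i j. (fps_nth g i * z ^ i) * a i j * (fps_nth h j * z ^ j))"
    by (simp add: power_double_seq_third_def power_add fun_eq_iff)
  then show ?thesis
    using regular_summability_diagonal_scaling_iff[OF assms(1)
        assms(2)[unfolded convergent_LIMSEQ_iff] assms(3)[unfolded convergent_LIMSEQ_iff]]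
    by simp
qed

end
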